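(* Setup: - Let $G$ be a graph containing a vertex $B$. Let $\tilde G$ be obtained from $G$ by adding a new vertex $A$ and a new edge $AB$. - Let $\tilde h,\tilde g\colon V(\tilde G)\to\mathbb N$, and put $h=\tilde h$, $g=\tilde g$ (where $h,g$ restricted to $V(G)$ give the game on $G$; we write $h(A)=\tilde h(A)$, $g(A)=\tilde g(A)$). - Let $w_A,w_B$ be natural numbers with $g(A)\le w_A\le h(A)$ and $g(B)\le w_B\le h(B)$. - Suppose: (i) the game with hint $\langle G,h|_{V(G)},g|_{V(G)},B,w_B\rangle$ is winning; (ii) $h(B)$ divides $w_B\cdot h(A)$; (iii) $w_Aw_B\ge (w_A-g(A))h(B)$. Conclusion: the game with hint $\langle\tilde G,\tilde h,\tilde g,A,w_A\rangle$ is winning.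
   Context: Hat guessing game $\langle G,h,g\rangle$: $G=(V,E)$ is a finite graph and $h,g\colon V\to\mathbb N$. The adversary gives each vertex $v$ a color in $\{0,\dots,h(v)-1\}$. Each vertex sees only its neighbors' colors and names at most $g(v)$ colors via a deterministic strategy fixed in advance. The game is winning if some strategy ensures that for every assignment some vertex names its own color. Game with hint $\langle G,h,g,B,w_B\rangle$, for a vertex $B$ and a natural number $w_B\le h(B)$: the game $\langle G,h,g\rangle$ modified as follows. In addition, sage $B$ (and only $B$) is told by the adversary a set of $w_B$ cyclically consecutive residues $\{x,x+1,\dots,x+w_B-1\}\bmod h(B)$ that contains the color of $B$'s hat. $B$'s list may depend on this set as well as on his neighbors' colors. The game is winning if there is a strategy that guarantees a correct guess for every hat assignment and every admissible hint. *)

theory Defs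
  imports "HOL-Library.FuncSet" "Graph_Theory.Pair_Digraph"
begin

text \<open>
  A finite simple graph is a \<^locale>\<open>pair_graph\<close>: a finite symmetric loopfree digraph, so an
  undirected edge consists of the two arcs (u, v) and (v, u).  The functions h and g are total;
  only their values on the vertices of the graph matter.
\<close>

definition neighbors :: "'a pair_pre_digraph \<Rightarrow> 'a \<Rightarrow> 'a set" where
  "neighbors G v = {u. (v, u) \<in> parcs G}"

definition add_pendant :: "'a pair_pre_digraph \<Rightarrow> 'a \<Rightarrow> 'a \<Rightarrow> 'a pair_pre_digraph" where
  "add_pendant G A B =
     \<lparr>pverts = insert A (pverts G), parcs = {(A, B), (B, A)} \<union> parcs G\<rparr>"

lemma pair_graph_add_pendant:
  assumes "pair_graph G" and "B \<in> pverts G" and "A \<notin> pverts G"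
  shows "pair_graph (add_pendant G A B)"
proof -
  interpret pair_graph G by fact
  have "sym (parcs G)"
    using pair_sym_arcs by (simp add: symmetric_def)
  then have "sym (parcs (add_pendant G A B))"
    by (auto simp: add_pendant_def sym_def)
  with assms(2,3) show ?thesis
    by unfold_locales
      (auto simp: add_pendant_def symmetric_def pair_finite_verts pair_finite_arcs
        dest: in_arcsD1 in_arcsD2 pair_no_loops)
qed

definition colorings :: "'a pair_pre_digraph \<Rightarrow> ('a \<Rightarrow> nat) \<Rightarrow> ('a \<Rightarrow> nat) set" where
  "colorings G h = (\<Pi>\<^sub>E v\<in>pverts G. {..<h v})"

definition cyclic_interval :: "nat \<Rightarrow> nat \<Rightarrow> nat \<Rightarrow> nat set" where
  "cyclic_interval n w x = {(x + i) mod n | i. i < w}"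

text \<open>
  In the game with hint, a strategy maps a vertex v, the hint available to v and the colors seen
  by v to the list of colors named by v.  The hint is the bare set (not its starting point x),
  and it is \<^const>\<open>None\<close> for every vertex other than B.  What v sees is the coloring
  restricted to the neighbors of v, so the answer cannot depend on any other color.
\<close>

type_synonym 'a hint_strategy = "'a \<Rightarrow> nat set option \<Rightarrow> ('a \<Rightarrow> nat) \<Rightarrow> nat set"

definition admissible_strategy ::
    "'a pair_pre_digraph \<Rightarrow> ('a \<Rightarrow> nat) \<Rightarrow> ('a \<Rightarrow> nat) \<Rightarrow> 'a hint_strategy \<Rightarrow> bool" where
  "admissible_strategy G h g F \<longleftrightarrow>
     (\<forall>v\<in>pverts G. \<forall>H s. F v H s \<subseteq> {..<h v} \<and> card (F v H s) \<le> g v)"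

definition hint_game_winning ::
    "'a pair_pre_digraph \<Rightarrow> ('a \<Rightarrow> nat) \<Rightarrow> ('a \<Rightarrow> nat) \<Rightarrow> 'a \<Rightarrow> nat \<Rightarrow> bool" where
  "hint_game_winning G h g B w \<longleftrightarrow>
     (\<exists>F. admissible_strategy G h g F \<and>
        (\<forall>c\<in>colorings G h. \<forall>x<h B. c B \<in> cyclic_interval (h B) w x \<longrightarrow>
           (\<exists>v\<in>pverts G.
              c v \<in> F v (if v = B then Some (cyclic_interval (h B) w x) else None)
                     (restrict c (neighbors G v)))))"

end

(*
  Seeing A's color a, sage B pretends to have received the hint {w_B a, ..., w_B a + w_B - 1} mod h(B)
  and everybody on G plays the winning strategy, which succeeds as soon as c(B) lies in that interval.
  By (ii) these intervals depend on a mod h(A) only, so when a runs through the hint of A they tile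
  w_A w_B consecutive residues.  By (iii) this covers c(B) at least w_A - g(A) times, so at most g(A)
  colors in A's hint are bad for G, and A, who sees c(B), names exactly those.
*)
theory Submission
  imports Defs
begin

lemma cyclic_interval_mod [simp]:
  "cyclic_interval n w (x mod n) = cyclic_interval n w x"
  by (simp add: cyclic_interval_def mod_add_left_eq)

text \<open>\<open>w * (a mod m)\<close> is \<open>w * a\<close> reduced mod \<open>w * m\<close>,
  and reducing first modulo a multiple of \<open>n\<close> leaves the residue mod \<open>n\<close>
  intact.\<close>

lemma cyclic_interval_mult_mod:
  assumes "n dvd w * m"
  shows "cyclic_interval n w (w * (a mod m)) = cyclic_interval n w (w * a)"
proof -
  have "w * (a mod m) mod n = w * a mod n"
    unfolding mult_mod_right using assms by (rule mod_mod_cancel)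
  then show ?thesis
    by (metis cyclic_interval_mod)
qed

lemma mod_mem_cyclic_interval:
  assumes "0 < w"
  shows "p mod n \<in> cyclic_interval n w (w * (p div w))"
  unfolding cyclic_interval_def
  using assms by (intro CollectI exI[of _ "p mod w"]) simp

text \<open>Unrolled to the integers, the tiles are adjacent blocks of length \<open>w\<close>
  filling a run of \<open>m * w\<close> numbers. This run holds at least \<open>k\<close> numbers
  congruent to \<open>c\<close> mod \<open>n\<close>; they are \<open>n\<close> apart, so
  \<open>w \<le> n\<close> puts them into distinct blocks.\<close>

lemma card_covering_tiles:
  assumes "c < n" and "w \<le> n" and "k * n \<le> m * w"
  shows "k \<le> card {i. i < m \<and> c \<in> cyclic_interval n w (w * (x + i))}"
proof (cases "w = 0")
  case True
  with assms show ?thesis by simp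
next
  case False
  \<comment> \<open>\<open>w * x + r\<close> is the first number from \<open>w * x\<close> on that
    is congruent to \<open>c\<close>; \<open>p j\<close> is the one \<open>j\<close> periods
    later.\<close>
  define r where "r = (c + (n - w * x mod n)) mod n"
  define p where "p j = w * x + (r + j * n)" for j
  have r: "r < n" using assms(1) by (simp add: r_def)
  have "(w * x + r) mod n = (w * x mod n + (c + (n - w * x mod n))) mod n"
    by (simp add: r_def mod_simps)
  also have "w * x mod n + (c + (n - w * x mod n)) = c + n"
    using mod_less_divisor[of n "w * x"] assms(1) by linarith
  finally have p_mod: "p j mod n = c" for j
    using assms(1) by (simp add: p_def flip: add.assoc)
  have p_less: "p j < w * (x + m)" if "j < k" for j
  proof -
    have "r + j * n < Suc j * n" using r by simp
    also have "\<dots> \<le> k * n" using that by (intro mult_le_mono1) simp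
    also have "\<dots> \<le> w * m" using assms(3) by (simp add: mult.commute)
    finally show ?thesis by (simp add: p_def algebra_simps)
  qed
  \<comment> \<open>Index, counted from \<open>x\<close>, of the block that contains
    \<open>p j\<close>.\<close>
  define f where "f j = (r + j * n) div w" for j
  have p_div: "p j div w = x + f j" for j
    using False by (simp add: p_def f_def)
  \<comment> \<open>A jump by \<open>n \<ge> w\<close> always leaves the current block.\<close>
  have "strict_mono f"
    unfolding strict_mono_Suc_iff
  proof
    fix j
    have "Suc (f j) = (r + j * n + w) div w"
      using False by (simp add: f_def)
    also have "\<dots> \<le> f (Suc j)"
      unfolding f_def using assms(2) by (intro div_le_mono) simp
    finally show "f j < f (Suc j)" by simp
  qed
  have "f ` {..<k} \<subseteq> {i. i < m \<and> c \<in> cyclic_interval n w (w * (x + i))}"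
  proof (intro image_subsetI CollectI conjI)
    fix j assume "j \<in> {..<k}"
    then have "p j < (x + m) * w"
      using p_less by (simp add: mult.commute)
    then have "p j div w < x + m"
      by (rule less_mult_imp_div_less)
    then show "f j < m"
      by (simp only: p_div add_less_cancel_left)
    show "c \<in> cyclic_interval n w (w * (x + f j))"
      using mod_mem_cyclic_interval[of w "p j" n] False by (simp only: p_mod p_div)
  qed
  then have "card (f ` {..<k}) \<le> card {i. i < m \<and> c \<in> cyclic_interval n w (w * (x + i))}"
    by (intro card_mono) auto
  then show ?thesis
    using strict_mono_imp_inj_on[OF \<open>strict_mono f\<close>] by (simp add: card_image)
qed

text \<open>Complementary count over the indices \<open>i < m\<close>. Passing from \<open>i\<close>
  to the color \<open>(x + i) mod q\<close> keeps the tile, by divisibility, and can only merge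
  indices.\<close>

lemma card_noncovering_tiles:
  assumes "n dvd w * q" and "c < n" and "w \<le> n" and "(m - k) * n \<le> m * w"
  shows "card {a \<in> cyclic_interval q m x. c \<notin> cyclic_interval n w (w * a)} \<le> k"
proof -
  let ?C = "{i. i < m \<and> c \<in> cyclic_interval n w (w * (x + i))}"
  let ?N = "{i. i < m \<and> c \<notin> cyclic_interval n w (w * (x + i))}"
  have "{a \<in> cyclic_interval q m x. c \<notin> cyclic_interval n w (w * a)} \<subseteq> (\<lambda>i. (x + i) mod q) ` ?N"
    unfolding cyclic_interval_def[of q]
    by (auto simp: cyclic_interval_mult_mod[OF assms(1)])
  then have "card {a \<in> cyclic_interval q m x. c \<notin> cyclic_interval n w (w * a)} \<le> card ?N"
    by (intro surj_card_le) auto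
  moreover have "card ?C + card ?N = m"
  proof -
    have "card ?C + card ?N = card (?C \<union> ?N)"
      by (intro card_Un_disjoint[symmetric]) auto
    also have "?C \<union> ?N = {..<m}" by auto
    finally show ?thesis by simp
  qed
  moreover have "m - k \<le> card ?C"
    using assms by (intro card_covering_tiles)
  ultimately show ?thesis by linarith
qed

lemma neighbors_subset_pverts:
  assumes "pair_graph G"
  shows "neighbors G v \<subseteq> pverts G"
proof -
  interpret pair_graph G by fact
  show ?thesis by (auto simp: neighbors_def dest: in_arcsD2)
qed

theorem theorem2p12:
  fixes G :: "'a pair_pre_digraph" and A B :: 'a
    and h g :: "'a \<Rightarrow> nat" and w\<^sub>A w\<^sub>B :: nat
  assumes "pair_graph G" and "B \<in> pverts G" and "A \<notin> pverts G"
    and "g A \<le> w\<^sub>A" and "w\<^sub>A \<le> h A"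
    and "g B \<le> w\<^sub>B" and "w\<^sub>B \<le> h B"
    and "hint_game_winning G h g B w\<^sub>B"
    and "h B dvd w\<^sub>B * h A"
    and "w\<^sub>A * w\<^sub>B \<ge> (w\<^sub>A - g A) * h B"
  shows "hint_game_winning (add_pendant G A B) h g A w\<^sub>A"
proof -
  let ?G = "add_pendant G A B"
  let ?I = "\<lambda>a. cyclic_interval (h B) w\<^sub>B (w\<^sub>B * a)"
  let ?J = "cyclic_interval (h A) w\<^sub>A"
  from assms(8) obtain F where F: "admissible_strategy G h g F"
    and win: "\<And>c x. c \<in> colorings G h \<Longrightarrow> x < h B \<Longrightarrow> c B \<in> cyclic_interval (h B) w\<^sub>B x \<Longrightarrow>
      \<exists>v\<in>pverts G. c v \<in> F v (if v = B then Some (cyclic_interval (h B) w\<^sub>B x) else None)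
        (restrict c (neighbors G v))"
    unfolding hint_game_winning_def by blast
  define T where "T J b = {a \<in> J. b \<notin> ?I a}" for J b
  \<comment> \<open>Admissibility constrains the answers to all arguments, including hints and views that never
    occur, so A's list is cut off when it is not legal.\<close>
  define F' where "F' v H s =
      (if v = A then
         (if T (the H) (s B) \<subseteq> {..<h A} \<and> card (T (the H) (s B)) \<le> g A then T (the H) (s B) else {})
       else if v = B then F B (Some (?I (s A))) (restrict s (neighbors G B))
       else F v None s)" for v H s
  have "A \<noteq> B" using assms(2,3) by auto
  have neighbors_B: "neighbors ?G B = insert A (neighbors G B)"
    using \<open>A \<noteq> B\<close> by (auto simp: neighbors_def add_pendant_def)
  have neighbors_other: "neighbors ?G v = neighbors G v" if "v \<noteq> A" "v \<noteq> B" for v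
    using that by (auto simp: neighbors_def add_pendant_def)
  have B_neighbor: "B \<in> neighbors ?G A"
    by (auto simp: neighbors_def add_pendant_def)
  have pverts: "pverts ?G = insert A (pverts G)"
    by (simp add: add_pendant_def)
  have "admissible_strategy ?G h g F'"
    using F assms(2) by (auto simp: admissible_strategy_def F'_def pverts)
  moreover have "\<exists>v\<in>pverts ?G. c v \<in> F' v (if v = A then Some (?J x) else None)
      (restrict c (neighbors ?G v))"
    if c: "c \<in> colorings ?G h" and x: "x < h A" and hint: "c A \<in> ?J x" for c x
  proof (cases "c B \<in> ?I (c A)")
    case True
    let ?c = "restrict c (pverts G)"
    have "?c \<in> colorings G h"
      using c by (auto simp: colorings_def pverts)
    \<comment> \<open>\<open>win\<close> wants a starting point below \<open>h B\<close>; reducing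
      it mod \<open>h B\<close> gives the same interval.\<close>
    moreover have "w\<^sub>B * c A mod h B < h B"
      using c assms(2) by (auto simp: colorings_def pverts PiE_def Pi_def intro: mod_less_divisor)
    moreover have "?c B \<in> cyclic_interval (h B) w\<^sub>B (w\<^sub>B * c A mod h B)"
      using True assms(2) by simp
    ultimately obtain v where v: "v \<in> pverts G"
      and "?c v \<in> F v (if v = B then Some (?I (c A)) else None) (restrict ?c (neighbors G v))"
      using win[of ?c "w\<^sub>B * c A mod h B"] unfolding cyclic_interval_mod by blast
    moreover have "pverts G \<inter> neighbors G v = neighbors G v"
      using neighbors_subset_pverts[OF assms(1)] by blast
    moreover have "v \<noteq> A" using v assms(3) by auto
    \<comment> \<open>In the new game even B is asked with \<open>None\<close>: \<open>F'\<close>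
      rebuilds the pretended hint from A's color in B's view, then drops that color to restore the
      view in \<open>G\<close>.\<close>
    ultimately have "c v \<in> F' v None (restrict c (neighbors ?G v))"
      by (cases "v = B") (auto simp: F'_def neighbors_other neighbors_B Int_absorb1 subset_insertI)
    with v \<open>v \<noteq> A\<close> show ?thesis
      by (auto simp: pverts)
  next
    case False
    have "c B < h B"
      using c assms(2) by (auto simp: colorings_def pverts)
    then have "card (T (?J x) (c B)) \<le> g A"
      unfolding T_def using assms(7,9,10) by (intro card_noncovering_tiles)
    moreover have "T (?J x) (c B) \<subseteq> {..<h A}"
      using x by (auto simp: T_def cyclic_interval_def)
    \<comment> \<open>Both legality tests succeed, so A's list is not cut off. It contains
      \<open>c A\<close>, which lies in the hint and whose tile misses \<open>c B\<close> in this
      case.\<close>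
    ultimately have "F' A (Some (?J x)) (restrict c (neighbors ?G A)) = T (?J x) (c B)"
      using B_neighbor by (simp add: F'_def)
    with False hint show ?thesis
      by (auto simp: T_def pverts)
  qed
  ultimately show ?thesis
    unfolding hint_game_winning_def by blast
qed

end
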